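(* Let $V_1\xrightarrow{\phi_1}V_2\xrightarrow{\phi_2}V_3\xrightarrow{\phi_3}\cdots$ be an inductive system in the category $\mathbf{OU}$ of ordered $*$-vector spaces with order units and unital positive linear maps, and let $\varinjlim_{\mathbf{OU}}V_k$ be its inductive limit in $\mathbf{OU}$. Then the state space $S(\varinjlim_{\mathbf{OU}}V_k)$ is homeomorphic to the inverse limit $\varprojlim_{\mathbf{Top}}S(V_k)$ of the inverse system $S(V_1)\xleftarrow{\phi_1'}S(V_2)\xleftarrow{\phi_2'}S(V_3)\xleftarrow{\phi_3'}\cdots$ of topological spaces, where $\phi_k'(f)=f\circ\phi_k$.
   Context: A $*$-vector space is a complex vector space $V$ with a conjugate-linear involution; $V_h$ is its set of selfadjoint elements. An ordered $*$-vector space is a pair $(V,V^+)$ with $V^+\subseteq V_h$ a cone such that $V^+\cap(-V^+)=\{0\}$. An order unit is $e\in V^+$ such that for each $x\in V_h$ there is $r>0$ with $re-x\in V^+$. Positive maps send cones into cones; unital maps preserve order units. $\mathbf{OU}$ is the category of ordered $*$-vector spaces with order units and unital positive linear maps. A state on $V$ is a unital positive linear functional $V\to\mathbb{C}$; $S(V)$ is the set of all states, with the weak* topology (pointwise convergence on $V$). The inductive limit of $(\{V_k\},\{\phi_k\})$ in $\mathbf{OU}$ is an object with morphisms $\ddot\phi_{k,\infty}$ from $V_k$ satisfying $\ddot\phi_{k+1,\infty}\circ\phi_k=\ddot\phi_{k,\infty}$ and universal with this property; it exists and is unique up to unital order isomorphism. The inverse limit in $\mathbf{Top}$ of $X_1\xleftarrow{f_1}X_2\xleftarrow{f_2}\cdots$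 is $\{(x_k)_k\in\prod_kX_k:f_k(x_{k+1})=x_k\ \forall k\}$ with the topology inherited from the product topology. *)

theory Defs
  imports "HOL-Analysis.Analysis" "HOL-Algebra.Module"
begin

definition complex_ring :: "complex ring" where
  "complex_ring = \<lparr>carrier = UNIV, mult = (*), one = 1, zero = 0, add = (+)\<rparr>"

text \<open>
  The fields \<open>mult\<close> and \<open>one\<close> inherited from the library's record of modules
  play no role.
\<close>

record 'a ordered_star_record = "(complex, 'a) module" +
  involution :: "'a \<Rightarrow> 'a"
  pos_cone :: "'a set"

record 'a ou_record = "'a ordered_star_record" +
  order_unit :: 'a

definition selfadjoint_part :: "('a, 'm) ordered_star_record_scheme \<Rightarrow> 'a set" where
  "selfadjoint_part V = {x \<in> carrier V. involution V x = x}"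

locale star_vector_space = module complex_ring V
  for V :: "('a, 'm) ordered_star_record_scheme" (structure) +
  assumes involution_closed: "x \<in> carrier V \<Longrightarrow> involution V x \<in> carrier V"
    and involution_involution: "x \<in> carrier V \<Longrightarrow> involution V (involution V x) = x"
    and involution_add: "\<lbrakk>x \<in> carrier V; y \<in> carrier V\<rbrakk> \<Longrightarrow>
          involution V (x \<oplus>\<^bsub>V\<^esub> y) = involution V x \<oplus>\<^bsub>V\<^esub> involution V y"
    and involution_smult: "x \<in> carrier V \<Longrightarrow>
          involution V (c \<odot>\<^bsub>V\<^esub> x) = cnj c \<odot>\<^bsub>V\<^esub> involution V x"

locale ordered_star_vector_space = star_vector_space V
  for V :: "('a, 'm) ordered_star_record_scheme" (structure) +
  assumes cone_selfadjoint: "pos_cone V \<subseteq> selfadjoint_part V"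
    and cone_add: "\<lbrakk>x \<in> pos_cone V; y \<in> pos_cone V\<rbrakk> \<Longrightarrow> x \<oplus>\<^bsub>V\<^esub> y \<in> pos_cone V"
    and cone_smult: "\<lbrakk>0 \<le> r; x \<in> pos_cone V\<rbrakk> \<Longrightarrow> complex_of_real r \<odot>\<^bsub>V\<^esub> x \<in> pos_cone V"
    and cone_proper: "pos_cone V \<inter> (\<lambda>x. \<ominus>\<^bsub>V\<^esub> x) ` pos_cone V = {\<zero>\<^bsub>V\<^esub>}"

locale ou_space = ordered_star_vector_space V
  for V :: "'a ou_record" (structure) +
  assumes unit_in_cone: "order_unit V \<in> pos_cone V"
    and unit_dominates: "x \<in> selfadjoint_part V \<Longrightarrow>
          \<exists>r>0. complex_of_real r \<odot>\<^bsub>V\<^esub> order_unit V \<ominus>\<^bsub>V\<^esub> x \<in> pos_cone V"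

text \<open>
  Morphisms are extensional functions on the carrier, so that equality of
  morphisms is equality of functions; correspondingly they are composed with
  \<^const>\<open>compose\<close>.
\<close>

definition ou_hom :: "'a ou_record \<Rightarrow> 'b ou_record \<Rightarrow> ('a \<Rightarrow> 'b) set" where
  "ou_hom V W = {f \<in> carrier V \<rightarrow>\<^sub>E carrier W.
     (\<forall>x\<in>carrier V. \<forall>y\<in>carrier V. f (x \<oplus>\<^bsub>V\<^esub> y) = f x \<oplus>\<^bsub>W\<^esub> f y) \<and>
     (\<forall>c. \<forall>x\<in>carrier V. f (c \<odot>\<^bsub>V\<^esub> x) = c \<odot>\<^bsub>W\<^esub> f x) \<and>
     f ` pos_cone V \<subseteq> pos_cone W \<and>
     f (order_unit V) = order_unit W}"

definition complex_ou :: "complex ou_record" where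
  "complex_ou = \<lparr>carrier = UNIV, mult = (*), one = 1, zero = 0, add = (+), smult = (*),
     involution = cnj, pos_cone = complex_of_real ` {0..}, order_unit = 1\<rparr>"

definition states :: "'a ou_record \<Rightarrow> ('a \<Rightarrow> complex) set" where
  "states V = ou_hom V complex_ou"

definition state_space :: "'a ou_record \<Rightarrow> ('a \<Rightarrow> complex) topology" where
  "state_space V =
     subtopology (product_topology (\<lambda>_. euclidean) (carrier V)) (states V)"

definition inductive_system ::
    "(nat \<Rightarrow> 'a ou_record) \<Rightarrow> (nat \<Rightarrow> 'a \<Rightarrow> 'a) \<Rightarrow> bool" where
  "inductive_system V \<phi> \<longleftrightarrow>
     (\<forall>k. ou_space (V k)) \<and> (\<forall>k. \<phi> k \<in> ou_hom (V k) (V (Suc k)))"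

definition ou_cocone ::
    "(nat \<Rightarrow> 'a ou_record) \<Rightarrow> (nat \<Rightarrow> 'a \<Rightarrow> 'a) \<Rightarrow> 'b ou_record \<Rightarrow> (nat \<Rightarrow> 'a \<Rightarrow> 'b) \<Rightarrow> bool"
  where
  "ou_cocone V \<phi> W \<psi> \<longleftrightarrow> ou_space W \<and>
     (\<forall>k. \<psi> k \<in> ou_hom (V k) W) \<and>
     (\<forall>k. compose (carrier (V k)) (\<psi> (Suc k)) (\<phi> k) = \<psi> k)"

definition ou_factors_uniquely ::
    "(nat \<Rightarrow> 'a ou_record) \<Rightarrow> 'b ou_record \<Rightarrow> (nat \<Rightarrow> 'a \<Rightarrow> 'b) \<Rightarrow>
     'c ou_record \<Rightarrow> (nat \<Rightarrow> 'a \<Rightarrow> 'c) \<Rightarrow> bool"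
  where
  "ou_factors_uniquely V L \<iota> W \<psi> \<longleftrightarrow>
     (\<exists>!u. u \<in> ou_hom L W \<and> (\<forall>k. compose (carrier (V k)) u (\<iota> k) = \<psi> k))"

text \<open>
  A formula cannot quantify over types, so the universal property is stated for
  the cocones whose apex \<open>W\<close> has its carrier in the type \<open>'a\<close> of the system or in
  the type \<open>'b\<close> of the limit. This already implies the property for apexes in every
  type. Indeed, the inductive limit \<open>L\<^sub>0\<close> (a union of images of the \<open>V k\<close>) has an
  isomorphic copy carried by a subset of \<open>'a\<close>: a nonzero complex vector space is
  infinite, hence so is \<open>'a\<close> unless all \<open>V k\<close> vanish, and an infinite \<open>'a\<close> has the
  cardinality of \<open>nat \<times> 'a\<close>. So \<open>L\<close> maps to \<open>L\<^sub>0\<close>; the composite \<open>L\<^sub>0 \<rightarrow> L \<rightarrow> L\<^sub>0\<close> is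
  the identity since \<open>L\<^sub>0\<close> is the limit, and the composite \<open>L \<rightarrow> L\<^sub>0 \<rightarrow> L\<close> is the
  identity by uniqueness for the apex \<open>L\<close> itself.
\<close>

definition is_ou_limit ::
    "(nat \<Rightarrow> 'a ou_record) \<Rightarrow> (nat \<Rightarrow> 'a \<Rightarrow> 'a) \<Rightarrow> 'b ou_record \<Rightarrow> (nat \<Rightarrow> 'a \<Rightarrow> 'b) \<Rightarrow> bool"
  where
  "is_ou_limit V \<phi> L \<iota> \<longleftrightarrow> ou_cocone V \<phi> L \<iota> \<and>
     (\<forall>(W :: 'a ou_record) \<psi>. ou_cocone V \<phi> W \<psi> \<longrightarrow> ou_factors_uniquely V L \<iota> W \<psi>) \<and>
     (\<forall>(W :: 'b ou_record) \<psi>. ou_cocone V \<phi> W \<psi> \<longrightarrow> ou_factors_uniquely V L \<iota> W \<psi>)"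

definition inverse_limit_topology ::
    "(nat \<Rightarrow> 'x topology) \<Rightarrow> (nat \<Rightarrow> 'x \<Rightarrow> 'x) \<Rightarrow> (nat \<Rightarrow> 'x) topology" where
  "inverse_limit_topology X f =
     subtopology (product_topology X UNIV) {x. \<forall>k. f k (x (Suc k)) = x k}"

definition dual_map :: "'a ou_record \<Rightarrow> ('a \<Rightarrow> 'b) \<Rightarrow> ('b \<Rightarrow> complex) \<Rightarrow> 'a \<Rightarrow> complex" where
  "dual_map V \<phi> f = compose (carrier V) f \<phi>"

end

theory Submission
  imports Defs
begin

text \<open>
  A state \<open>g\<close> of the limit is sent to the compatible family of the states \<open>g \<circ> \<iota> k\<close>. Conversely, a
  compatible family of states is a cocone with apex the complex numbers, so it factors through the
  limit. Since the images of the \<open>\<iota> k\<close> exhaust the limit, this map is injective, and evaluating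
  its inverse at \<open>\<iota> k x\<close> is evaluating the \<open>k\<close>-th member of the family at \<open>x\<close>, so the inverse is
  continuous without any appeal to compactness.
\<close>

section \<open>Scalar arithmetic and selfadjoint parts in star-vector spaces\<close>

lemma complex_ring_simps [simp]:
  "carrier complex_ring = UNIV" "mult complex_ring = (*)" "one complex_ring = 1"
  "zero complex_ring = 0" "add complex_ring = (+)"
  by (simp_all add: complex_ring_def)

context star_vector_space
begin

lemma scale_closed [simp]: "x \<in> carrier V \<Longrightarrow> c \<odot>\<^bsub>V\<^esub> x \<in> carrier V"
  by (rule smult_closed) simp_all

lemma scale_scale: "x \<in> carrier V \<Longrightarrow> a \<odot>\<^bsub>V\<^esub> (b \<odot>\<^bsub>V\<^esub> x) = (a * b) \<odot>\<^bsub>V\<^esub> x"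
  using smult_assoc1[of a b x] by simp

lemma scale_one: "x \<in> carrier V \<Longrightarrow> 1 \<odot>\<^bsub>V\<^esub> x = x"
  using smult_one[of x] by simp

lemma scale_zero: "x \<in> carrier V \<Longrightarrow> 0 \<odot>\<^bsub>V\<^esub> x = \<zero>\<^bsub>V\<^esub>"
  using smult_l_null[of x] by simp

lemma scale_left_distrib:
  "x \<in> carrier V \<Longrightarrow> (a + b) \<odot>\<^bsub>V\<^esub> x = a \<odot>\<^bsub>V\<^esub> x \<oplus>\<^bsub>V\<^esub> b \<odot>\<^bsub>V\<^esub> x"
  using smult_l_distr[of a b x] by simp

lemma scale_right_distrib:
  "\<lbrakk>x \<in> carrier V; y \<in> carrier V\<rbrakk> \<Longrightarrow>
     a \<odot>\<^bsub>V\<^esub> (x \<oplus>\<^bsub>V\<^esub> y) = a \<odot>\<^bsub>V\<^esub> x \<oplus>\<^bsub>V\<^esub> a \<odot>\<^bsub>V\<^esub> y"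
  using smult_r_distr[of a x y] by simp

text \<open>The inverse \<open>a_inv\<close> refers to the carrier of the structure, whereas
  \<open>smult\<close> is shared by a space and its subspaces. Writing inverses with the scalar -1
  is what allows them to be compared between the two.\<close>

lemma a_inv_eq_scale:
  assumes "x \<in> carrier V"
  shows "\<ominus>\<^bsub>V\<^esub> x = (-1) \<odot>\<^bsub>V\<^esub> x"
proof -
  have "(-1) \<odot>\<^bsub>V\<^esub> x \<oplus>\<^bsub>V\<^esub> x = \<zero>\<^bsub>V\<^esub>"
    using scale_left_distrib[of x "-1" 1] assms by (simp add: scale_one scale_zero)
  then show ?thesis
    using assms by (intro M.minus_equality) auto
qed

lemma a_minus_eq_scale:
  assumes "y \<in> carrier V"
  shows "x \<ominus>\<^bsub>V\<^esub> y = x \<oplus>\<^bsub>V\<^esub> (-1) \<odot>\<^bsub>V\<^esub> y"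
  by (simp add: a_minus_def a_inv_eq_scale assms)

text \<open>Real and imaginary parts: with \<open>y = involution V x\<close>, take
  \<open>h = (x + y)/2\<close> and \<open>k = (x - y)/(2i)\<close>.\<close>

lemma selfadjoint_decomposition:
  assumes x: "x \<in> carrier V"
  obtains h k where "h \<in> selfadjoint_part V" "k \<in> selfadjoint_part V"
    "x = h \<oplus>\<^bsub>V\<^esub> \<i> \<odot>\<^bsub>V\<^esub> k" "involution V x = h \<oplus>\<^bsub>V\<^esub> (-\<i>) \<odot>\<^bsub>V\<^esub> k"
proof -
  let ?y = "involution V x"
  have y: "?y \<in> carrier V" and yy: "involution V ?y = x"
    using x by (auto simp: involution_closed involution_involution)
  define h where "h = (1/2) \<odot>\<^bsub>V\<^esub> x \<oplus>\<^bsub>V\<^esub> (1/2) \<odot>\<^bsub>V\<^esub> ?y"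
  define k where "k = (-\<i>/2) \<odot>\<^bsub>V\<^esub> x \<oplus>\<^bsub>V\<^esub> (\<i>/2) \<odot>\<^bsub>V\<^esub> ?y"
  have "h \<in> selfadjoint_part V" "k \<in> selfadjoint_part V"
    using x y by (simp_all add: h_def k_def selfadjoint_part_def involution_add
        involution_smult yy M.a_comm)
  \<comment> \<open>A free scalar \<open>c\<close> serves both identities: \<open>c = \<i>\<close>
    kills the coefficient of \<open>?y\<close>, and \<open>c = -\<i>\<close> that of
    \<open>x\<close>.\<close>
  moreover have split: "h \<oplus>\<^bsub>V\<^esub> c \<odot>\<^bsub>V\<^esub> k
      = (1/2 - c * \<i>/2) \<odot>\<^bsub>V\<^esub> x \<oplus>\<^bsub>V\<^esub> (1/2 + c * \<i>/2) \<odot>\<^bsub>V\<^esub> ?y" for c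
  proof -
    have "h \<oplus>\<^bsub>V\<^esub> c \<odot>\<^bsub>V\<^esub> k = ((1/2) \<odot>\<^bsub>V\<^esub> x \<oplus>\<^bsub>V\<^esub> (c * (-\<i>/2)) \<odot>\<^bsub>V\<^esub> x)
        \<oplus>\<^bsub>V\<^esub> ((1/2) \<odot>\<^bsub>V\<^esub> ?y \<oplus>\<^bsub>V\<^esub> (c * (\<i>/2)) \<odot>\<^bsub>V\<^esub> ?y)"
      using x y by (simp add: h_def k_def scale_right_distrib scale_scale M.a_ac)
    also have "\<dots> = (1/2 + c * (-\<i>/2)) \<odot>\<^bsub>V\<^esub> x \<oplus>\<^bsub>V\<^esub> (1/2 + c * (\<i>/2)) \<odot>\<^bsub>V\<^esub> ?y"
      using x y by (simp only: scale_left_distrib)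
    finally show ?thesis by simp
  qed
  moreover have "x = h \<oplus>\<^bsub>V\<^esub> \<i> \<odot>\<^bsub>V\<^esub> k" "?y = h \<oplus>\<^bsub>V\<^esub> (-\<i>) \<odot>\<^bsub>V\<^esub> k"
    unfolding split using x y by (simp_all add: scale_one scale_zero)
  ultimately show ?thesis using that by blast
qed

lemma selfadjoint_add_scale:
  "\<lbrakk>x \<in> selfadjoint_part V; y \<in> selfadjoint_part V\<rbrakk> \<Longrightarrow>
     complex_of_real r \<odot>\<^bsub>V\<^esub> x \<oplus>\<^bsub>V\<^esub> complex_of_real s \<odot>\<^bsub>V\<^esub> y \<in> selfadjoint_part V"
  by (simp add: selfadjoint_part_def involution_add involution_smult)

end

section \<open>Cones, and subspaces containing the order unit\<close>

context ou_space
begin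

lemma cone_carrier: "x \<in> pos_cone V \<Longrightarrow> x \<in> carrier V"
  and cone_involution: "x \<in> pos_cone V \<Longrightarrow> involution V x = x"
  using cone_selfadjoint by (auto simp: selfadjoint_part_def)

lemma unit_carrier [simp]: "order_unit V \<in> carrier V"
  by (rule cone_carrier[OF unit_in_cone])

lemma cone_antisym:
  assumes "x \<in> pos_cone V" "(-1) \<odot>\<^bsub>V\<^esub> x \<in> pos_cone V"
  shows "x = \<zero>\<^bsub>V\<^esub>"
proof -
  have "x = \<ominus>\<^bsub>V\<^esub> ((-1) \<odot>\<^bsub>V\<^esub> x)"
    using cone_carrier[OF assms(1)] by (simp add: a_inv_eq_scale scale_scale scale_one)
  then show ?thesis using cone_proper assms by blast
qed

lemma zero_in_cone: "\<zero>\<^bsub>V\<^esub> \<in> pos_cone V"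
  using cone_proper by auto

end

text \<open>The subspace \<open>H\<close> with the induced order. It keeps the carrier type of
  \<open>V\<close>, so a subspace of the limit is an apex to which the universal property
  applies.\<close>

definition restrict_ou :: "'a ou_record \<Rightarrow> 'a set \<Rightarrow> 'a ou_record" where
  "restrict_ou V H = V\<lparr>carrier := H, pos_cone := pos_cone V \<inter> H\<rparr>"

lemma restrict_ou_simps [simp]:
  "carrier (restrict_ou V H) = H" "add (restrict_ou V H) = add V"
  "zero (restrict_ou V H) = zero V" "smult (restrict_ou V H) = smult V"
  "involution (restrict_ou V H) = involution V"
  "pos_cone (restrict_ou V H) = pos_cone V \<inter> H"
  "order_unit (restrict_ou V H) = order_unit V"
  by (simp_all add: restrict_ou_def)

text \<open>The algebraic and order axioms are inherited by a star-invariant subspace. The unit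
  \<open>e\<close> still dominates because \<open>r e - x\<close> lies in \<open>H\<close> together
  with \<open>e\<close> and \<open>x\<close>.\<close>

lemma (in ou_space) ou_space_restrict_ou:
  assumes H: "H \<subseteq> carrier V" and e: "order_unit V \<in> H"
    and add: "\<And>x y. \<lbrakk>x \<in> H; y \<in> H\<rbrakk> \<Longrightarrow> x \<oplus>\<^bsub>V\<^esub> y \<in> H"
    and scale: "\<And>c x. x \<in> H \<Longrightarrow> c \<odot>\<^bsub>V\<^esub> x \<in> H"
    and inv: "\<And>x. x \<in> H \<Longrightarrow> involution V x \<in> H"
  shows "ou_space (restrict_ou V H)"
proof -
  \<comment> \<open>The zero vector enters \<open>H\<close> as 0 times the order unit.\<close>
  have zero: "\<zero>\<^bsub>V\<^esub> \<in> H"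
    using scale[OF e, of 0] by (simp add: scale_zero)
  have mod: "module complex_ring (restrict_ou V H)"
  proof (rule moduleI)
    show "cring complex_ring" by (rule R.is_cring)
    show "abelian_group (restrict_ou V H)"
    proof (rule abelian_groupI)
      fix x assume x: "x \<in> carrier (restrict_ou V H)"
      then have "(-1) \<odot>\<^bsub>V\<^esub> x \<oplus>\<^bsub>V\<^esub> x = \<zero>\<^bsub>V\<^esub>"
        using H scale_left_distrib[of x "-1" 1] by (auto simp: scale_one scale_zero)
      then show "\<exists>y\<in>carrier (restrict_ou V H).
          y \<oplus>\<^bsub>restrict_ou V H\<^esub> x = \<zero>\<^bsub>restrict_ou V H\<^esub>"
        using x scale by auto
    qed (use H add zero in \<open>auto simp: subset_iff M.a_ac\<close>)
  qed (use H scale in \<open>auto simp: subset_iff scale_left_distrib scale_right_distrib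
      scale_scale scale_one\<close>)
  have star: "star_vector_space (restrict_ou V H)"
    by (intro star_vector_space.intro mod star_vector_space_axioms.intro)
      (use H inv in \<open>auto simp: subset_iff involution_add involution_smult involution_involution\<close>)
  interpret W: star_vector_space "restrict_ou V H" by (rule star)
  \<comment> \<open>Inverse and difference are formed relative to the smaller carrier; through the
    scalar -1 they agree with those of \<open>V\<close> as long as the subtracted element is in
    \<open>H\<close>.\<close>
  have minus: "\<ominus>\<^bsub>restrict_ou V H\<^esub> x = (-1) \<odot>\<^bsub>V\<^esub> x" if "x \<in> H" for x
    using W.a_inv_eq_scale[of x] that by simp
  have sub: "x \<ominus>\<^bsub>restrict_ou V H\<^esub> y = x \<ominus>\<^bsub>V\<^esub> y" if "y \<in> H" for x y
    using that H by (auto simp: W.a_minus_eq_scale a_minus_eq_scale)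
  have "ordered_star_vector_space (restrict_ou V H)"
  proof (intro ordered_star_vector_space.intro star ordered_star_vector_space_axioms.intro)
    show "pos_cone (restrict_ou V H) \<inter>
        (\<lambda>x. \<ominus>\<^bsub>restrict_ou V H\<^esub> x) ` pos_cone (restrict_ou V H) = {\<zero>\<^bsub>restrict_ou V H\<^esub>}"
    proof
      show "pos_cone (restrict_ou V H) \<inter>
        (\<lambda>x. \<ominus>\<^bsub>restrict_ou V H\<^esub> x) ` pos_cone (restrict_ou V H) \<subseteq> {\<zero>\<^bsub>restrict_ou V H\<^esub>}"
        using minus cone_antisym H by (auto simp: scale_scale scale_one)
      have "\<zero>\<^bsub>V\<^esub> = \<ominus>\<^bsub>restrict_ou V H\<^esub> \<zero>\<^bsub>V\<^esub>"
        using minus[OF zero] smult_r_null[of "-1"] by simp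
      then show "{\<zero>\<^bsub>restrict_ou V H\<^esub>} \<subseteq> pos_cone (restrict_ou V H) \<inter>
        (\<lambda>x. \<ominus>\<^bsub>restrict_ou V H\<^esub> x) ` pos_cone (restrict_ou V H)"
        using zero zero_in_cone by auto
    qed
  qed (use H cone_add cone_smult add scale in
      \<open>auto simp: selfadjoint_part_def cone_involution\<close>)
  then show ?thesis
  proof (intro ou_space.intro ou_space_axioms.intro)
    fix x assume "x \<in> selfadjoint_part (restrict_ou V H)"
    then have x: "x \<in> H" "x \<in> selfadjoint_part V"
      using H by (auto simp: selfadjoint_part_def)
    then obtain r where r: "r > 0"
      "complex_of_real r \<odot>\<^bsub>V\<^esub> order_unit V \<ominus>\<^bsub>V\<^esub> x \<in> pos_cone V"
      using unit_dominates by blast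
    moreover have "complex_of_real r \<odot>\<^bsub>V\<^esub> order_unit V \<ominus>\<^bsub>V\<^esub> x \<in> H"
      unfolding a_minus_eq_scale[OF subsetD[OF H x(1)]] by (intro add scale e x(1))
    ultimately show "\<exists>r>0. complex_of_real r \<odot>\<^bsub>restrict_ou V H\<^esub> order_unit (restrict_ou V H)
        \<ominus>\<^bsub>restrict_ou V H\<^esub> x \<in> pos_cone (restrict_ou V H)"
      using x(1) by (simp add: sub) blast
  qed (use e unit_in_cone in auto)
qed

section \<open>Unital positive maps\<close>

lemma ou_homD:
  assumes "f \<in> ou_hom V W"
  shows "x \<in> carrier V \<Longrightarrow> f x \<in> carrier W"
    and "\<lbrakk>x \<in> carrier V; y \<in> carrier V\<rbrakk> \<Longrightarrow> f (x \<oplus>\<^bsub>V\<^esub> y) = f x \<oplus>\<^bsub>W\<^esub> f y"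
    and "x \<in> carrier V \<Longrightarrow> f (c \<odot>\<^bsub>V\<^esub> x) = c \<odot>\<^bsub>W\<^esub> f x"
    and "x \<in> pos_cone V \<Longrightarrow> f x \<in> pos_cone W"
    and "f (order_unit V) = order_unit W"
    and "f \<in> extensional (carrier V)"
  using assms by (auto simp: ou_hom_def PiE_def)

text \<open>Compatibility with the involution is not part of \<open>ou_hom\<close> but follows from
  positivity: the order unit makes every selfadjoint element a difference of two positive ones, so
  its image is selfadjoint, and the general case splits into real and imaginary parts.\<close>

lemma ou_hom_involution:
  assumes V: "ou_space V" and W: "ou_space W" and f: "f \<in> ou_hom V W" and x: "x \<in> carrier V"
  shows "f (involution V x) = involution W (f x)"
proof -
  interpret V: ou_space V by (rule V)
  interpret W: ou_space W by (rule W)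
  note f_simps = ou_homD(2,3)[OF f]
  have sa: "f h \<in> selfadjoint_part W" if h: "h \<in> selfadjoint_part V" for h
  proof -
    obtain r where r: "complex_of_real r \<odot>\<^bsub>V\<^esub> order_unit V \<ominus>\<^bsub>V\<^esub> h \<in> pos_cone V" (is "?p \<in> _")
      using V.unit_dominates[OF h] by blast
    have hc: "h \<in> carrier V" using h by (simp add: selfadjoint_part_def)
    \<comment> \<open>This is \<open>h = r e - (r e - h)\<close>, a real combination of two positive
      elements. The coefficient is written \<open>complex_of_real (-1)\<close> to fit
      \<open>selfadjoint_add_scale\<close>.\<close>
    have "h = complex_of_real r \<odot>\<^bsub>V\<^esub> order_unit V \<oplus>\<^bsub>V\<^esub> complex_of_real (-1) \<odot>\<^bsub>V\<^esub> ?p"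
    proof -
      have "complex_of_real r \<odot>\<^bsub>V\<^esub> order_unit V \<oplus>\<^bsub>V\<^esub> complex_of_real (-1) \<odot>\<^bsub>V\<^esub> ?p
          = (complex_of_real r \<odot>\<^bsub>V\<^esub> order_unit V \<oplus>\<^bsub>V\<^esub> (- complex_of_real r) \<odot>\<^bsub>V\<^esub> order_unit V) \<oplus>\<^bsub>V\<^esub> h"
        using hc by (simp add: V.a_minus_eq_scale V.scale_right_distrib V.scale_scale V.scale_one
            V.M.a_assoc)
      also have "\<dots> = h"
        using hc by (simp flip: V.scale_left_distrib add: V.scale_zero)
      finally show ?thesis by simp
    qed
    then have "f h = complex_of_real r \<odot>\<^bsub>W\<^esub> f (order_unit V) \<oplus>\<^bsub>W\<^esub> complex_of_real (-1) \<odot>\<^bsub>W\<^esub> f ?p"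
      using V.cone_carrier[OF r] f_simps
      by (metis V.scale_closed V.unit_carrier)
    then show ?thesis
      using W.selfadjoint_add_scale W.cone_selfadjoint ou_homD(4)[OF f] r V.unit_in_cone
      by (metis subsetD)
  qed
  obtain h k where hk: "h \<in> selfadjoint_part V" "k \<in> selfadjoint_part V"
    "x = h \<oplus>\<^bsub>V\<^esub> \<i> \<odot>\<^bsub>V\<^esub> k" "involution V x = h \<oplus>\<^bsub>V\<^esub> (-\<i>) \<odot>\<^bsub>V\<^esub> k"
    using V.selfadjoint_decomposition[OF x] by blast
  moreover have "h \<in> carrier V" "k \<in> carrier V"
    using hk by (auto simp: selfadjoint_part_def)
  ultimately show ?thesis
    using sa[OF hk(1)] sa[OF hk(2)]
    by (simp add: f_simps selfadjoint_part_def W.involution_add W.involution_smult)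
qed

lemma ou_hom_compose:
  assumes V: "ou_space V" and f: "f \<in> ou_hom V W" and g: "g \<in> ou_hom W X"
  shows "compose (carrier V) g f \<in> ou_hom V X"
proof -
  interpret V: ou_space V by (rule V)
  show ?thesis
    using ou_homD[OF f] ou_homD[OF g] V.unit_carrier V.cone_carrier
    by (auto simp: ou_hom_def compose_def)
qed

lemma ou_hom_into_restrict:
  assumes "ou_space V" and f: "f \<in> ou_hom V W" and "f ` carrier V \<subseteq> H"
  shows "f \<in> ou_hom V (restrict_ou W H)"
proof -
  interpret V: ou_space V by fact
  show ?thesis
    using ou_homD[OF f] assms(3) V.cone_carrier
    by (auto simp: ou_hom_def PiE_def)
qed

lemma ou_hom_from_into_restrict:
  assumes f: "f \<in> ou_hom V (restrict_ou W H)" and "H \<subseteq> carrier W"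
  shows "f \<in> ou_hom V W"
  using f assms(2) by (auto simp: ou_hom_def PiE_def)

lemma ou_hom_id: "ou_space V \<Longrightarrow> restrict (\<lambda>x. x) (carrier V) \<in> ou_hom V V"
proof -
  assume "ou_space V"
  then interpret ou_space V .
  show ?thesis
    using cone_carrier by (auto simp: ou_hom_def)
qed

text \<open>The line through a nonzero order unit serves as a copy of the complex numbers inside a
  given carrier type; the universal property is only available for apexes in such types.\<close>

locale nonzero_ou_space = ou_space +
  assumes unit_nonzero: "order_unit V \<noteq> \<zero>\<^bsub>V\<^esub>"
begin

definition unit_line :: "'a ou_record" where
  "unit_line = restrict_ou V (range (\<lambda>c. c \<odot>\<^bsub>V\<^esub> order_unit V))"

text \<open>If \<open>a\<close> and \<open>b\<close> differed, dividing \<open>(a - b) e = 0\<close>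
  by \<open>a - b\<close> would give \<open>e = 0\<close>, against
  \<open>unit_nonzero\<close>.\<close>

lemma scale_unit_eq_iff [simp]:
  "a \<odot>\<^bsub>V\<^esub> order_unit V = b \<odot>\<^bsub>V\<^esub> order_unit V \<longleftrightarrow> a = b"
proof
  assume eq: "a \<odot>\<^bsub>V\<^esub> order_unit V = b \<odot>\<^bsub>V\<^esub> order_unit V"
  have "(a - b) \<odot>\<^bsub>V\<^esub> order_unit V = b \<odot>\<^bsub>V\<^esub> order_unit V \<oplus>\<^bsub>V\<^esub> (- b) \<odot>\<^bsub>V\<^esub> order_unit V"
    using eq scale_left_distrib[OF unit_carrier, of a "-b"] by simp
  also have "\<dots> = \<zero>\<^bsub>V\<^esub>"
    by (simp flip: scale_left_distrib add: scale_zero)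
  finally have 0: "(a - b) \<odot>\<^bsub>V\<^esub> order_unit V = \<zero>\<^bsub>V\<^esub>" .
  show "a = b"
  proof (rule ccontr)
    assume "a \<noteq> b"
    then have "order_unit V = inverse (a - b) \<odot>\<^bsub>V\<^esub> ((a - b) \<odot>\<^bsub>V\<^esub> order_unit V)"
      by (simp add: scale_scale scale_one)
    also have "\<dots> = \<zero>\<^bsub>V\<^esub>"
      using 0 smult_r_null[of "inverse (a - b)"] by simp
    finally show False using unit_nonzero by simp
  qed
qed auto

text \<open>This identifies the cone of the unit line with the nonnegative reals. Elements of the
  cone are selfadjoint, which forces \<open>c\<close> to be real; a negative \<open>c\<close> would
  put both \<open>e\<close> and \<open>-e\<close> into the cone, so \<open>e = 0\<close>.\<close>

lemma scale_unit_in_cone_iff: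
  "c \<odot>\<^bsub>V\<^esub> order_unit V \<in> pos_cone V \<longleftrightarrow> c \<in> complex_of_real ` {0..}"
proof
  assume pos: "c \<odot>\<^bsub>V\<^esub> order_unit V \<in> pos_cone V"
  then have "cnj c \<odot>\<^bsub>V\<^esub> order_unit V = c \<odot>\<^bsub>V\<^esub> order_unit V"
    using cone_involution[OF pos] cone_involution[OF unit_in_cone] by (simp add: involution_smult)
  then have c: "c = complex_of_real (Re c)"
    by (simp add: complex_eq_iff)
  have "0 \<le> Re c"
  proof (rule ccontr)
    assume neg: "\<not> 0 \<le> Re c"
    \<comment> \<open>The factor \<open>-1 / Re c\<close> is positive and rescales \<open>c\<close>
      to exactly -1.\<close>
    have "complex_of_real (- inverse (Re c)) \<odot>\<^bsub>V\<^esub> (c \<odot>\<^bsub>V\<^esub> order_unit V) \<in> pos_cone V"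
      using neg by (intro cone_smult pos) simp
    moreover have "complex_of_real (- inverse (Re c)) * c = -1"
      using neg by (subst c) (simp flip: of_real_mult)
    ultimately have "(-1) \<odot>\<^bsub>V\<^esub> order_unit V \<in> pos_cone V"
      by (simp add: scale_scale)
    then show False
      using cone_antisym unit_in_cone unit_nonzero by blast
  qed
  then show "c \<in> complex_of_real ` {0..}"
    using c by (metis atLeast_iff imageI)
qed (auto intro: cone_smult unit_in_cone)

lemma ou_space_unit_line: "ou_space unit_line"
  unfolding unit_line_def
  by (rule ou_space_restrict_ou)
    (auto simp: scale_scale involution_smult cone_involution[OF unit_in_cone]
      simp flip: scale_left_distrib intro: range_eqI[of _ _ 1] simp: scale_one)

lemma scale_unit_ou_hom: "(\<lambda>c. c \<odot>\<^bsub>V\<^esub> order_unit V) \<in> ou_hom complex_ou unit_line"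
  by (auto simp: ou_hom_def complex_ou_def unit_line_def scale_left_distrib scale_scale scale_one
      intro: cone_smult unit_in_cone)

text \<open>The way back from the line to the complex numbers. Its positivity is the nontrivial
  direction of \<open>scale_unit_in_cone_iff\<close>; \<open>restrict\<close> makes it extensional,
  as morphisms must be.\<close>

lemma unit_line_coordinate_ou_hom:
  "restrict (inv_into UNIV (\<lambda>c. c \<odot>\<^bsub>V\<^esub> order_unit V)) (carrier unit_line) \<in> ou_hom unit_line complex_ou"
proof -
  have inj: "inj (\<lambda>c. c \<odot>\<^bsub>V\<^esub> order_unit V)" by (simp add: inj_def)
  have one: "order_unit V = 1 \<odot>\<^bsub>V\<^esub> order_unit V" by (simp add: scale_one)
  have coord: "inv_into UNIV (\<lambda>c. c \<odot>\<^bsub>V\<^esub> order_unit V) (c \<odot>\<^bsub>V\<^esub> order_unit V) = c" for c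
    using inv_f_f[OF inj, of c] by simp
  have "inv_into UNIV (\<lambda>c. c \<odot>\<^bsub>V\<^esub> order_unit V) (order_unit V) = 1"
    by (subst (2) one) (rule coord)
  moreover have "order_unit V \<in> range (\<lambda>c. c \<odot>\<^bsub>V\<^esub> order_unit V)"
    using one by blast
  ultimately show ?thesis
    by (auto simp: ou_hom_def complex_ou_def unit_line_def coord scale_scale
        scale_unit_in_cone_iff simp flip: scale_left_distrib)
qed

end

section \<open>Elements and states of the inductive limit\<close>

lemma ou_cocone_image_mono:
  assumes "inductive_system V \<phi>" "ou_cocone V \<phi> W \<psi>" "k \<le> l"
  shows "\<psi> k ` carrier (V k) \<subseteq> \<psi> l ` carrier (V l)"
proof (rule lift_Suc_mono_le[of "\<lambda>k. \<psi> k ` carrier (V k)"])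
  fix n
  have "\<psi> n x = \<psi> (Suc n) (\<phi> n x)" "\<phi> n x \<in> carrier (V (Suc n))" if "x \<in> carrier (V n)" for x
    using assms that unfolding inductive_system_def ou_cocone_def
    by (metis compose_eq, metis ou_homD(1))
  then show "\<psi> n ` carrier (V n) \<subseteq> \<psi> (Suc n) ` carrier (V (Suc n))" by auto
qed (rule assms(3))

text \<open>The union of the images is itself the apex of a cocone. Its mediating map, followed by the
  inclusion, must be the identity of the limit.\<close>

lemma ou_limit_eq_union_images:
  fixes V :: "nat \<Rightarrow> 'a ou_record" and L :: "'b ou_record"
  assumes sys: "inductive_system V \<phi>" and lim: "is_ou_limit V \<phi> L \<iota>"
  shows "carrier L = (\<Union>k. \<iota> k ` carrier (V k))"
proof
  let ?H = "\<Union>k. \<iota> k ` carrier (V k)"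
  have coc: "ou_cocone V \<phi> L \<iota>" using lim by (simp add: is_ou_limit_def)
  have V: "ou_space (V k)" for k using sys by (simp add: inductive_system_def)
  have \<iota>: "\<iota> k \<in> ou_hom (V k) L" for k using coc by (simp add: ou_cocone_def)
  interpret L: ou_space L using coc by (simp add: ou_cocone_def)
  show H: "?H \<subseteq> carrier L" using ou_homD(1)[OF \<iota>] by blast
  have W: "ou_space (restrict_ou L ?H)"
  proof (rule L.ou_space_restrict_ou[OF H])
    \<comment> \<open>Any stage would serve, since every \<open>\<iota> k\<close> is unital.\<close>
    have "\<iota> 0 (order_unit (V 0)) \<in> ?H"
      using ou_space.unit_carrier[OF V] by blast
    then show "order_unit L \<in> ?H"
      by (simp only: ou_homD(5)[OF \<iota>])
  next
    fix x y assume "x \<in> ?H" "y \<in> ?H"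
    then obtain k l where kl: "x \<in> \<iota> k ` carrier (V k)" "y \<in> \<iota> l ` carrier (V l)" by blast
    \<comment> \<open>The images increase with the stage, so both summands come from stage
      \<open>m\<close>, where they can be added before applying \<open>\<iota> m\<close>.\<close>
    define m where "m = max k l"
    have "x \<in> \<iota> m ` carrier (V m)" "y \<in> \<iota> m ` carrier (V m)"
      using subsetD[OF ou_cocone_image_mono[OF sys coc] kl(1), of m]
        subsetD[OF ou_cocone_image_mono[OF sys coc] kl(2), of m] by (simp_all add: m_def)
    then obtain a b where ab: "a \<in> carrier (V m)" "x = \<iota> m a" "b \<in> carrier (V m)" "y = \<iota> m b"
      by (elim imageE)
    interpret Vm: ou_space "V m" by (rule V)
    have "x \<oplus>\<^bsub>L\<^esub> y = \<iota> m (a \<oplus>\<^bsub>V m\<^esub> b)"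
      using ab ou_homD(2)[OF \<iota>] by simp
    moreover have "a \<oplus>\<^bsub>V m\<^esub> b \<in> carrier (V m)" using ab by simp
    ultimately show "x \<oplus>\<^bsub>L\<^esub> y \<in> ?H" by blast
  next
    fix c x assume "x \<in> ?H"
    then obtain k a where ka: "a \<in> carrier (V k)" "x = \<iota> k a" by blast
    interpret Vk: ou_space "V k" by (rule V)
    have "c \<odot>\<^bsub>L\<^esub> x = \<iota> k (c \<odot>\<^bsub>V k\<^esub> a)" "involution L x = \<iota> k (involution (V k) a)"
      using ka ou_homD(3)[OF \<iota>] ou_hom_involution[OF V L.ou_space_axioms \<iota>] by simp_all
    moreover have "c \<odot>\<^bsub>V k\<^esub> a \<in> carrier (V k)" "involution (V k) a \<in> carrier (V k)"
      using ka Vk.involution_closed by simp_all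
    ultimately show "c \<odot>\<^bsub>L\<^esub> x \<in> ?H" "involution L x \<in> ?H" by blast+
  qed
  have "ou_cocone V \<phi> (restrict_ou L ?H) \<iota>"
    using W coc unfolding ou_cocone_def by (auto intro: ou_hom_into_restrict V)
  \<comment> \<open>The carrier of this apex has the type of the limit, so the second clause of
    \<open>is_ou_limit\<close> supplies \<open>u\<close>.\<close>
  then obtain u where u: "u \<in> ou_hom L (restrict_ou L ?H)"
    "\<And>k. compose (carrier (V k)) u (\<iota> k) = \<iota> k"
    using lim unfolding is_ou_limit_def ou_factors_uniquely_def by blast
  let ?id = "restrict (\<lambda>x. x) (carrier L)"
  \<comment> \<open>With its codomain enlarged to \<open>L\<close>, \<open>u\<close> can be compared
    with the identity: both factor the cocone \<open>\<iota>\<close> through itself, and uniqueness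
    for the apex \<open>L\<close> identifies them.\<close>
  have "u \<in> ou_hom L L" by (rule ou_hom_from_into_restrict[OF u(1) H])
  moreover have "?id \<in> ou_hom L L" by (rule ou_hom_id) (rule L.ou_space_axioms)
  moreover have "compose (carrier (V k)) ?id (\<iota> k) = \<iota> k" for k
    using ou_homD(1)[OF \<iota>, of _ k] ou_homD(6)[OF \<iota>, of k]
    by (auto simp: compose_def restrict_def extensional_def)
  ultimately have "u = ?id"
    using lim u(2) coc unfolding is_ou_limit_def ou_factors_uniquely_def by blast
  \<comment> \<open>Each \<open>y\<close> in the carrier of \<open>L\<close> equals
    \<open>u y\<close>, and \<open>u\<close> takes values in the union.\<close>
  then show "carrier L \<subseteq> ?H"
    using ou_homD(1)[OF u(1)] by auto
qed

text \<open>The complex numbers need not have the carrier type of the system or of the limit. The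
  family is therefore moved to the line spanned by the order unit of \<open>V 0\<close>, factored
  there, and brought back by the coordinate map.\<close>

lemma ou_limit_state_exists:
  fixes V :: "nat \<Rightarrow> 'a ou_record" and L :: "'b ou_record"
  assumes sys: "inductive_system V \<phi>" and lim: "is_ou_limit V \<phi> L \<iota>"
    and F: "\<And>k. F k \<in> states (V k)"
    and compat: "\<And>k. dual_map (V k) (\<phi> k) (F (Suc k)) = F k"
  shows "\<exists>g\<in>states L. \<forall>k. compose (carrier (V k)) g (\<iota> k) = F k"
proof -
  have V: "ou_space (V k)" and \<phi>: "\<phi> k \<in> ou_hom (V k) (V (Suc k))" for k
    using sys by (simp_all add: inductive_system_def)
  have coc: "ou_cocone V \<phi> L \<iota>" using lim by (simp add: is_ou_limit_def)
  have \<iota>: "\<iota> k \<in> ou_hom (V k) L" for k using coc by (simp add: ou_cocone_def)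
  interpret L: ou_space L using coc by (simp add: ou_cocone_def)
  have F': "F k \<in> ou_hom (V k) complex_ou" for k using F by (simp add: states_def)
  interpret V0: ou_space "V 0" by (rule V)
  \<comment> \<open>The state \<open>F 0\<close> separates the order unit of \<open>V 0\<close> from
    zero, so the unit line really is a copy of the complex numbers.\<close>
  have "F 0 \<zero>\<^bsub>V 0\<^esub> = 0"
    using ou_homD(3)[OF F'[of 0], of "\<zero>\<^bsub>V 0\<^esub>" 0] by (simp add: V0.scale_zero complex_ou_def)
  moreover have "F 0 (order_unit (V 0)) = 1"
    using ou_homD(5)[OF F'] by (simp add: complex_ou_def)
  ultimately interpret V0: nonzero_ou_space "V 0"
    by unfold_locales auto
  let ?h = "\<lambda>c. c \<odot>\<^bsub>V 0\<^esub> order_unit (V 0)"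
  let ?p = "restrict (inv_into UNIV ?h) (carrier V0.unit_line)"
  define \<psi> where "\<psi> k = compose (carrier (V k)) ?h (F k)" for k
  have "ou_cocone V \<phi> V0.unit_line \<psi>"
    unfolding ou_cocone_def
  proof (intro conjI allI)
    show "\<psi> k \<in> ou_hom (V k) V0.unit_line" for k
      unfolding \<psi>_def by (rule ou_hom_compose[OF V F' V0.scale_unit_ou_hom])
    show "compose (carrier (V k)) (\<psi> (Suc k)) (\<phi> k) = \<psi> k" for k
    proof
      fix x
      show "compose (carrier (V k)) (\<psi> (Suc k)) (\<phi> k) x = \<psi> k x"
        using ou_homD(1)[OF \<phi>, of x k] fun_cong[OF compat[of k], of x]
        by (auto simp: \<psi>_def compose_def dual_map_def)
    qed
  qed (rule V0.ou_space_unit_line)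
  \<comment> \<open>The unit line has its carrier in type \<open>'a\<close>, so the first clause of
    \<open>is_ou_limit\<close> applies.\<close>
  then obtain u where u: "u \<in> ou_hom L V0.unit_line"
    "\<And>k. compose (carrier (V k)) u (\<iota> k) = \<psi> k"
    using lim unfolding is_ou_limit_def ou_factors_uniquely_def by blast
  have "compose (carrier L) ?p u \<in> states L"
    unfolding states_def by (rule ou_hom_compose[OF _ u(1) V0.unit_line_coordinate_ou_hom])
      (rule L.ou_space_axioms)
  moreover have "compose (carrier (V k)) (compose (carrier L) ?p u) (\<iota> k) = F k" for k
  proof
    fix x
    show "compose (carrier (V k)) (compose (carrier L) ?p u) (\<iota> k) x = F k x"
    proof (cases "x \<in> carrier (V k)")
      case True
      have "u (\<iota> k x) = ?h (F k x)"
        using fun_cong[OF u(2)[of k], of x] True by (simp add: \<psi>_def compose_def)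
      moreover have "inv_into UNIV ?h (?h (F k x)) = F k x"
        by (rule inv_f_f) (simp add: inj_def)
      ultimately show ?thesis
        using True ou_homD(1)[OF \<iota> True] ou_homD(1)[OF u(1), of "\<iota> k x"] by (simp add: compose_def)
    next
      \<comment> \<open>Off the carrier both sides are \<open>undefined\<close>, because states are
        extensional.\<close>
      case False
      then show ?thesis using ou_homD(6)[OF F', of k] by (simp add: compose_def extensional_def)
    qed
  qed
  ultimately show ?thesis by blast
qed

section \<open>The weak* topology on state spaces\<close>

lemma topspace_state_space [simp]: "topspace (state_space V) = states V"
  by (auto simp: state_space_def states_def ou_hom_def complex_ou_def)

text \<open>The weak* topology is the initial topology of the evaluations. The product also demands
  extensional values, which membership in \<open>states V\<close> already guarantees.\<close>

lemma continuous_map_state_space_iff: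
  "continuous_map X (state_space V) f \<longleftrightarrow>
     f \<in> topspace X \<rightarrow> states V \<and> (\<forall>x\<in>carrier V. continuous_map X euclidean (\<lambda>t. f t x))"
  by (auto simp: state_space_def continuous_map_in_subtopology continuous_map_componentwise
      states_def ou_hom_def PiE_def Pi_iff image_subset_iff)

lemma continuous_map_state_eval:
  "x \<in> carrier V \<Longrightarrow> continuous_map (state_space V) euclidean (\<lambda>f. f x)"
  unfolding state_space_def
  by (intro continuous_map_from_subtopology continuous_map_product_projection)

section \<open>The homeomorphism\<close>

theorem proposition3p7:
  fixes V :: "nat \<Rightarrow> 'a ou_record"
    and \<phi> :: "nat \<Rightarrow> 'a \<Rightarrow> 'a"
    and L :: "'b ou_record"
    and \<iota> :: "nat \<Rightarrow> 'a \<Rightarrow> 'b"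
  assumes "inductive_system V \<phi>"
    and "is_ou_limit V \<phi> L \<iota>"
  shows "state_space L homeomorphic_space
           inverse_limit_topology (\<lambda>k. state_space (V k)) (\<lambda>k. dual_map (V k) (\<phi> k))"
    (is "_ homeomorphic_space ?I")
proof -
  have V: "ou_space (V k)" and \<phi>: "\<phi> k \<in> ou_hom (V k) (V (Suc k))" for k
    using assms(1) by (simp_all add: inductive_system_def)
  have coc: "ou_cocone V \<phi> L \<iota>" using assms(2) by (simp add: is_ou_limit_def)
  have \<iota>: "\<iota> k \<in> ou_hom (V k) L"
    and \<iota>_Suc: "compose (carrier (V k)) (\<iota> (Suc k)) (\<phi> k) = \<iota> k" for k
    using coc by (simp_all add: ou_cocone_def)
  have top: "topspace ?I =
      {F. (\<forall>k. F k \<in> states (V k)) \<and> (\<forall>k. dual_map (V k) (\<phi> k) (F (Suc k)) = F k)}"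
    by (auto simp: inverse_limit_topology_def PiE_iff)
  define \<Phi> where "\<Phi> g = (\<lambda>k. compose (carrier (V k)) g (\<iota> k))" for g :: "'b \<Rightarrow> complex"
  have \<Phi>_states: "\<Phi> g k \<in> states (V k)" if "g \<in> states L" for g k
    using ou_hom_compose[OF V \<iota>] that by (simp add: \<Phi>_def states_def)
  \<comment> \<open>Only the cocone identity \<open>\<iota>_Suc\<close> enters, so \<open>g\<close>
    may be an arbitrary function here.\<close>
  have \<Phi>_compat: "dual_map (V k) (\<phi> k) (\<Phi> g (Suc k)) = \<Phi> g k" for g k
  proof
    fix x
    show "dual_map (V k) (\<phi> k) (\<Phi> g (Suc k)) x = \<Phi> g k x"
      using ou_homD(1)[OF \<phi>, of x k] fun_cong[OF \<iota>_Suc[of k], of x]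
      by (auto simp: dual_map_def \<Phi>_def compose_def)
  qed
  have inj: "inj_on \<Phi> (states L)"
  proof (rule inj_onI)
    fix f g assume f: "f \<in> states L" and g: "g \<in> states L" and eq: "\<Phi> f = \<Phi> g"
    have ext: "f \<in> extensional (carrier L)" "g \<in> extensional (carrier L)"
      using f g ou_homD(6) by (auto simp: states_def)
    show "f = g"
    proof (rule extensionalityI[OF ext])
      \<comment> \<open>Every point of the limit comes from some stage, where \<open>\<Phi>\<close>
        records the value of the state.\<close>
      fix y assume "y \<in> carrier L"
      then obtain k x where "x \<in> carrier (V k)" "y = \<iota> k x"
        using ou_limit_eq_union_images[OF assms] by blast
      then show "f y = g y"
        using fun_cong[OF fun_cong[OF eq, of k], of x] by (simp add: \<Phi>_def compose_def)
    qed
  qed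
  have surj: "\<Phi> ` states L = topspace ?I"
  proof
    show "\<Phi> ` states L \<subseteq> topspace ?I"
      using \<Phi>_states \<Phi>_compat by (auto simp: top)
    show "topspace ?I \<subseteq> \<Phi> ` states L"
    proof
      fix F assume "F \<in> topspace ?I"
      then obtain g where "g \<in> states L" "\<forall>k. compose (carrier (V k)) g (\<iota> k) = F k"
        using ou_limit_state_exists[OF assms, of F] by (auto simp: top)
      then show "F \<in> \<Phi> ` states L" by (intro image_eqI[of _ _ g]) (auto simp: \<Phi>_def)
    qed
  qed
  define \<Psi> where "\<Psi> = inv_into (states L) \<Phi>"
  have \<Psi>_\<Phi>: "\<Psi> (\<Phi> g) = g" if "g \<in> states L" for g
    using inj that by (simp add: \<Psi>_def)
  have \<Phi>_\<Psi>: "\<Phi> (\<Psi> F) = F" and \<Psi>_states: "\<Psi> F \<in> states L" if "F \<in> topspace ?I" for F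
    using that unfolding \<Psi>_def surj[symmetric] by (rule f_inv_into_f, rule inv_into_into)
  have cont_\<Phi>: "continuous_map (state_space L) ?I \<Phi>"
    unfolding inverse_limit_topology_def continuous_map_in_subtopology
      continuous_map_componentwise_UNIV continuous_map_state_space_iff
  proof (intro conjI allI ballI)
    \<comment> \<open>The \<open>k\<close>-th member of \<open>\<Phi> g\<close> at \<open>x\<close>
      is \<open>g\<close> evaluated at the fixed point \<open>\<iota> k x\<close>.\<close>
    fix k x assume "x \<in> carrier (V k)"
    then show "continuous_map (state_space L) euclidean (\<lambda>g. \<Phi> g k x)"
      using continuous_map_state_eval[OF ou_homD(1)[OF \<iota>]] by (simp add: \<Phi>_def compose_def)
  qed (use \<Phi>_states \<Phi>_compat in auto)
  have cont_\<Psi>: "continuous_map ?I (state_space L) \<Psi>"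
    unfolding continuous_map_state_space_iff
  proof (intro conjI ballI)
    \<comment> \<open>The choice of \<open>k\<close> and \<open>x\<close> depends on
      \<open>y\<close> alone and not on \<open>F\<close>, so evaluation of \<open>\<Psi> F\<close>
      at \<open>y\<close> is a single composite: projection to stage \<open>k\<close>, then
      evaluation at \<open>x\<close>.\<close>
    fix y assume "y \<in> carrier L"
    then obtain k x where kx: "x \<in> carrier (V k)" "y = \<iota> k x"
      using ou_limit_eq_union_images[OF assms] by blast
    have "continuous_map ?I (state_space (V k)) (\<lambda>F. F k)"
      unfolding inverse_limit_topology_def
      by (intro continuous_map_from_subtopology continuous_map_product_projection) simp
    then have "continuous_map ?I euclidean (\<lambda>F. F k x)"
      using continuous_map_compose[OF _ continuous_map_state_eval[OF kx(1)]]
      by (simp add: o_def)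
    \<comment> \<open>This is the identity \<open>\<Phi> (\<Psi> F) = F\<close> read at stage
      \<open>k\<close> and point \<open>x\<close>.\<close>
    moreover have "F k x = \<Psi> F y" if "F \<in> topspace ?I" for F
      using fun_cong[OF fun_cong[OF \<Phi>_\<Psi>[OF that], of k], of x] kx
      by (simp add: \<Phi>_def compose_def)
    ultimately show "continuous_map ?I euclidean (\<lambda>F. \<Psi> F y)"
      by (rule continuous_map_eq)
  qed (use \<Psi>_states in auto)
  have "homeomorphic_maps (state_space L) ?I \<Phi> \<Psi>"
    unfolding homeomorphic_maps_def using cont_\<Phi> cont_\<Psi> \<Psi>_\<Phi> \<Phi>_\<Psi> by auto
  then show ?thesis
    by (auto simp: homeomorphic_space_def)
qed

end
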